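(* There exists a universal constant $c>0$ such that for every $n\ge1$ and all increasing functions $f,g:\{-1,1\}^n\to\{0,1\}$, $$ \mathrm{Cor}(f,g)\ \ge\ c\sum_{i=1}^n \mathrm{I}_i(f)\,\mathrm{I}_i(g)\,\min\left(\frac{1}{\sqrt{\log\left(\frac{e}{\mathrm{I}_i(f)\mathrm{I}_i(g)}\right)}},\ \frac{\mathrm{I}_i(f)\,\mathrm{I}_i(g)}{|\langle \mathrm{V}_i(f),\mathrm{V}_i(g)\rangle|}\right). $$
   Context: Let $\mu$ be the uniform probability measure on $\{-1,1\}^n$ and $\mathbb{E}$ the expectation with respect to $\mu$. For $f:\{-1,1\}^n\to\mathbb{R}$ and $i\in\{1,\dots,n\}$, the discrete derivative is $\partial_i f(x)=\frac12\big(f(x;x_i\to 1)-f(x;x_i\to -1)\big)$, where $(x;x_i\to a)$ denotes $x$ with its $i$-th coordinate replaced by $a$. A function $f:\{-1,1\}^n\to\{0,1\}$ is increasing if $\partial_i f(x)\ge 0$ for all $i$ and $x$. The influence of the $i$-th coordinate is $\mathrm{I}_i(f)=2\int|\partial_i f(x)|\,d\mu(x)$. The vector $\mathrm{V}_i(f)\in\mathbb{R}^n$ is $\mathrm{V}_i(f)=\big(\mathbb{E}[\partial_1\partial_i f],\dots,\mathbb{E}[\partial_n\partial_i f]\big)$. The correlation is $\mathrm{Cor}(f,g)=\mathbb{E}[fg]-\mathbb{E}[f]\,\mathbb{E}[g]$. Here $\log$ is the natural logarithm. Conventions: the $i$-th summand is $0$ if $\mathrm{I}_i(f)\mathrm{I}_i(g)=0$;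 if $\mathrm{I}_i(f)\mathrm{I}_i(g)>0$ and $\langle \mathrm{V}_i(f),\mathrm{V}_i(g)\rangle=0$, the second term of the minimum is $+\infty$. The constant $c$ does not depend on $n,f,g$. *)

theory Defs
  imports "HOL-Probability.Probability"
begin

(* Points of the cube are extensional functions on {1..n}; this makes the cube a finite
   set for each n while allowing n to be quantified inside formulas. *)
definition cube :: "nat \<Rightarrow> (nat \<Rightarrow> real) set" where
  "cube n = {1..n} \<rightarrow>\<^sub>E {-1, 1}"

definition expect :: "nat \<Rightarrow> ((nat \<Rightarrow> real) \<Rightarrow> real) \<Rightarrow> real" where
  "expect n f = measure_pmf.expectation (pmf_of_set (cube n)) f"

(* For i in {1..n} both updated points stay in cube n, so on the cube the derivative
   depends only on the values of f on the cube. *)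
definition dderiv :: "nat \<Rightarrow> ((nat \<Rightarrow> real) \<Rightarrow> real) \<Rightarrow> (nat \<Rightarrow> real) \<Rightarrow> real" where
  "dderiv i f x = (f (x(i := 1)) - f (x(i := -1))) / 2"

definition cube_increasing :: "nat \<Rightarrow> ((nat \<Rightarrow> real) \<Rightarrow> real) \<Rightarrow> bool" where
  "cube_increasing n f \<longleftrightarrow> (\<forall>i\<in>{1..n}. \<forall>x\<in>cube n. dderiv i f x \<ge> 0)"

definition influence :: "nat \<Rightarrow> nat \<Rightarrow> ((nat \<Rightarrow> real) \<Rightarrow> real) \<Rightarrow> real" where
  "influence n i f = 2 * expect n (\<lambda>x. \<bar>dderiv i f x\<bar>)"

(* Vectors of length n are functions on nat of which only the components 1..n are used. *)
definition Vvec :: "nat \<Rightarrow> nat \<Rightarrow> ((nat \<Rightarrow> real) \<Rightarrow> real) \<Rightarrow> nat \<Rightarrow> real" where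
  "Vvec n i f j = expect n (dderiv j (dderiv i f))"

definition dot :: "nat \<Rightarrow> (nat \<Rightarrow> real) \<Rightarrow> (nat \<Rightarrow> real) \<Rightarrow> real" where
  "dot n u v = (\<Sum>j=1..n. u j * v j)"

definition Cor :: "nat \<Rightarrow> ((nat \<Rightarrow> real) \<Rightarrow> real) \<Rightarrow> ((nat \<Rightarrow> real) \<Rightarrow> real) \<Rightarrow> real" where
  "Cor n f g = expect n (\<lambda>x. f x * g x) - expect n f * expect n g"

(* The summand p * min (1 / sqrt (ln (e / p))) (p / |s|), where it is 0 if p = 0, and
   where p / |s| is read as +infinity if p > 0 and s = 0 (the minimum is then its first
   argument).  The conventions are explicit because division by 0 yields 0 on the reals. *)
definition corr_term :: "real \<Rightarrow> real \<Rightarrow> real" where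
  "corr_term p s =
     (if p = 0 then 0
      else if s = 0 then p * (1 / sqrt (ln (exp 1 / p)))
      else p * min (1 / sqrt (ln (exp 1 / p))) (p / \<bar>s\<bar>))"

end

theory Submission
  imports Defs
begin

text \<open>Let \<open>N\<^sub>\<rho>(f, g) = E[f(x) g(y)]\<close> for \<open>\<rho>\<close>-correlated \<open>x\<close>, \<open>y\<close>.  Since the derivative of
  \<open>N\<^sub>\<rho>(f, g)\<close> in \<open>\<rho>\<close> is the sum of the \<open>N\<^sub>\<rho>(\<partial>\<^sub>i f, \<partial>\<^sub>i g)\<close>, the correlation is the sum over \<open>i\<close> of
  the integrals of these nonnegative functions over \<open>[0, 1]\<close>.  Now \<open>2 \<partial>\<^sub>i f\<close> and \<open>2 \<partial>\<^sub>i g\<close> are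
  indicators of sets of measure \<open>I\<^sub>i(f)\<close> and \<open>I\<^sub>i(g)\<close>, and for small \<open>\<rho>\<close> the entropic bound
  \<open>ln_noise_ge\<close> controls the loss in \<open>N\<^sub>\<rho>(\<partial>\<^sub>i f, \<partial>\<^sub>i g) \<ge> c I\<^sub>i(f) I\<^sub>i(g)\<close> by
  \<open>\<rho> |\<langle>V\<^sub>i(f), V\<^sub>i(g)\<rangle>| / p + \<rho>\<^sup>2 ln (1/p)\<close> in the exponent, where \<open>p = I\<^sub>i(f) I\<^sub>i(g)\<close>.  This is bounded
  on an interval whose length is a constant times the minimum in the theorem.\<close>

section \<open>Expectations and the noise form\<close>

text \<open>A slice keeps the type of \<open>f\<close>, so for a function on
  \<open>cube (Suc n)\<close> its slice at \<open>Suc n\<close> serves directly as a function on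
  \<open>cube n\<close>. Every induction on the dimension rests on this.\<close>

definition slice :: "nat \<Rightarrow> real \<Rightarrow> ((nat \<Rightarrow> real) \<Rightarrow> real) \<Rightarrow> (nat \<Rightarrow> real) \<Rightarrow> real" where
  "slice i s f x = f (x(i := s))"

lemma finite_cube [simp]: "finite (cube n)"
  and cube_nonempty [simp]: "cube n \<noteq> {}"
  by (auto simp: cube_def finite_PiE PiE_eq_empty_iff)

lemma cube_0: "cube 0 = {\<lambda>_. undefined}"
  by (simp add: cube_def)

lemma cube_Suc: "cube (Suc n) = (\<lambda>(s, x). x(Suc n := s)) ` ({1, -1} \<times> cube n)"
proof -
  have "{1..Suc n} = insert (Suc n) {1..n}" by auto
  then show ?thesis
    unfolding cube_def by (simp add: PiE_insert_eq insert_commute)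
qed

lemma fun_upd_cube_Suc: "s = 1 \<or> s = -1 \<Longrightarrow> x \<in> cube n \<Longrightarrow> x(Suc n := s) \<in> cube (Suc n)"
  by (force simp: cube_Suc)

lemma fun_upd_cube: "i \<in> {1..n} \<Longrightarrow> s = 1 \<or> s = -1 \<Longrightarrow> x \<in> cube n \<Longrightarrow> x(i := s) \<in> cube n"
  by (auto simp: cube_def PiE_iff extensional_def)

lemma sum_cube_Suc:
  "(\<Sum>x\<in>cube (Suc n). f x) = (\<Sum>s\<in>{1, -1}. \<Sum>x\<in>cube n. slice (Suc n) s f x)"
proof -
  have inj: "inj_on (\<lambda>(s, x). x(Suc n := s)) ({1, -1} \<times> cube n)"
    using inj_combinator[of "Suc n" "{1..n}" "\<lambda>_. {1, -1 :: real}"]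
    by (simp add: cube_def insert_commute)
  show ?thesis
    unfolding cube_Suc sum.reindex[OF inj] sum.cartesian_product
    by (intro sum.cong) (auto simp: slice_def)
qed

lemma card_cube: "card (cube n) = 2 ^ n"
  by (simp add: cube_def card_PiE numeral_2_eq_2)

lemma expect_sum: "expect n f = (\<Sum>x\<in>cube n. f x) / 2 ^ n"
  unfolding expect_def by (subst integral_pmf_of_set) (auto simp: card_cube)

lemma expect_0 [simp]: "expect 0 f = f (\<lambda>_. undefined)"
  by (simp add: expect_sum cube_0)

lemma expect_Suc:
  "expect (Suc n) f = (expect n (slice (Suc n) 1 f) + expect n (slice (Suc n) (-1) f)) / 2"
  by (simp add: expect_sum sum_cube_Suc add_divide_distrib mult.commute)

lemma expect_cong: "(\<And>x. x \<in> cube n \<Longrightarrow> f x = g x) \<Longrightarrow> expect n f = expect n g"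
  by (simp add: expect_sum)

lemma expect_mono: "(\<And>x. x \<in> cube n \<Longrightarrow> f x \<le> g x) \<Longrightarrow> expect n f \<le> expect n g"
  by (simp add: expect_sum sum_mono divide_right_mono)

lemma expect_const [simp]: "expect n (\<lambda>_. c) = c"
  by (simp add: expect_sum card_cube)

lemma expect_cmult: "expect n (\<lambda>x. c * f x) = c * expect n f"
  by (simp add: expect_sum sum_distrib_left)

lemma expect_nonneg: "(\<And>x. x \<in> cube n \<Longrightarrow> 0 \<le> f x) \<Longrightarrow> 0 \<le> expect n f"
  using expect_mono[of n "\<lambda>_. 0" f] by simp

lemma expect_eq_0_iff:
  assumes "\<And>x. x \<in> cube n \<Longrightarrow> 0 \<le> f x"
  shows "expect n f = 0 \<longleftrightarrow> (\<forall>x\<in>cube n. f x = 0)"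
  using assms by (simp add: expect_sum sum_nonneg_eq_0_iff)

section \<open>Discrete derivatives under slicing and averaging\<close>

lemma slice_dderiv:
  "i \<noteq> j \<Longrightarrow> slice i s (dderiv j f) = dderiv j (slice i s f)"
  by (auto simp: slice_def dderiv_def fun_upd_twist)

text \<open>The derivative in direction \<open>i\<close> ignores coordinate \<open>i\<close>, so
  \<open>s\<close> disappears. The right side is spelled as a linear combination to match the
  linearity rules for \<open>noise\<close>.\<close>

lemma slice_dderiv_same:
  "slice i s (dderiv i f) = (\<lambda>x. 1/2 * slice i 1 f x + (- 1/2) * slice i (-1) f x)"
  by (auto simp: slice_def dderiv_def field_simps)

lemma expect_diff: "expect n (\<lambda>x. f x - g x) = expect n f - expect n g"
  by (simp add: expect_sum sum_subtractf diff_divide_distrib)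

text \<open>Averaging \<open>f x * x j\<close> over the sign \<open>x j\<close> alone already gives
  the derivative. Thus the components of \<open>Vvec\<close> are first-order Fourier coefficients of
  derivatives.\<close>

lemma expect_dderiv:
  "j \<in> {1..n} \<Longrightarrow> expect n (dderiv j f) = expect n (\<lambda>x. f x * x j)"
proof (induction n arbitrary: f)
  case (Suc n)
  show ?case
  proof (cases "j = Suc n")
    case True
    have "slice (Suc n) s (\<lambda>x. f x * x (Suc n)) = (\<lambda>x. s * slice (Suc n) s f x)" for s
      by (auto simp: slice_def)
    moreover have "slice (Suc n) s (dderiv (Suc n) f)
        = (\<lambda>x. 1/2 * slice (Suc n) 1 f x - 1/2 * slice (Suc n) (-1) f x)" for s
      by (auto simp: slice_dderiv_same)
    ultimately show ?thesis
      unfolding True expect_Suc by (simp only: expect_diff expect_cmult) simp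
  next
    case False
    have "slice (Suc n) s (\<lambda>x. f x * x j) = (\<lambda>x. slice (Suc n) s f x * x j)" for s
      using False by (auto simp: slice_def)
    then show ?thesis
      using False Suc by (simp add: expect_Suc slice_dderiv)
  qed
qed simp

text \<open>\<open>noise \<rho> n f g\<close> is the expectation of \<open>f x * g y\<close> for \<open>x\<close>, \<open>y\<close> uniform on the cube with
  \<open>\<rho>\<close>-correlated coordinates.\<close>

fun noise :: "real \<Rightarrow> nat \<Rightarrow> ((nat \<Rightarrow> real) \<Rightarrow> real) \<Rightarrow> ((nat \<Rightarrow> real) \<Rightarrow> real) \<Rightarrow> real" where
  "noise \<rho> 0 f g = f (\<lambda>_. undefined) * g (\<lambda>_. undefined)"
| "noise \<rho> (Suc n) f g =
    (\<Sum>s\<in>{1, -1}. \<Sum>t\<in>{1, -1}.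
       (1 + \<rho> * s * t) / 4 * noise \<rho> n (slice (Suc n) s f) (slice (Suc n) t g))"

text \<open>Independent points at \<rho> = 0, equal points at \<rho> = 1 (next lemma): the
  correlation is the increment of \<open>noise\<close> between these ends.\<close>

lemma noise_0: "noise 0 n f g = expect n f * expect n g"
  by (induction n arbitrary: f g) (simp_all add: expect_Suc field_simps)

lemma noise_1: "noise 1 n f g = expect n (\<lambda>x. f x * g x)"
proof (induction n arbitrary: f g)
  case (Suc n)
  have "slice (Suc n) s (\<lambda>x. f x * g x) = (\<lambda>x. slice (Suc n) s f x * slice (Suc n) s g x)" for s
    by (auto simp: slice_def)
  then show ?case by (simp add: expect_Suc Suc field_simps)
qed simp

lemma noise_nonneg:
  assumes "\<bar>\<rho>\<bar> \<le> 1" "\<And>x. x \<in> cube n \<Longrightarrow> 0 \<le> f x" "\<And>x. x \<in> cube n \<Longrightarrow> 0 \<le> g x"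
  shows "0 \<le> noise \<rho> n f g"
  using assms(2,3)
proof (induction n arbitrary: f g)
  case 0
  then show ?case by (simp add: cube_0)
next
  case (Suc n)
  have "0 \<le> noise \<rho> n (slice (Suc n) s f) (slice (Suc n) t g)" if "s \<in> {1, -1}" "t \<in> {1, -1}" for s t
    using that Suc.prems by (intro Suc.IH) (auto simp: slice_def intro!: fun_upd_cube_Suc)
  moreover have "0 \<le> 1 + \<rho> * s * t" if "s \<in> {1, -1}" "t \<in> {1, -1}" for s t
    using that assms(1) by auto
  ultimately show ?case
    unfolding noise.simps by (intro sum_nonneg mult_nonneg_nonneg divide_nonneg_nonneg) auto
qed

section \<open>Bilinearity of the noise form and its derivative in \<rho>\<close>

lemma noise_linear_left:
  "noise \<rho> n (\<lambda>x. c * f x + d * f' x) g = c * noise \<rho> n f g + d * noise \<rho> n f' g"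
proof (induction n arbitrary: f f' g)
  case (Suc n)
  have "slice (Suc n) s (\<lambda>x. c * f x + d * f' x)
      = (\<lambda>x. c * slice (Suc n) s f x + d * slice (Suc n) s f' x)" for s
    by (auto simp: slice_def)
  then show ?case by (simp add: Suc field_simps)
qed (simp add: algebra_simps)

lemma noise_linear_right:
  "noise \<rho> n f (\<lambda>x. c * g x + d * g' x) = c * noise \<rho> n f g + d * noise \<rho> n f g'"
proof (induction n arbitrary: f g g')
  case (Suc n)
  have "slice (Suc n) s (\<lambda>x. c * g x + d * g' x)
      = (\<lambda>x. c * slice (Suc n) s g x + d * slice (Suc n) s g' x)" for s
    by (auto simp: slice_def)
  then show ?case by (simp add: Suc field_simps)
qed (simp add: algebra_simps)

lemma noise_cmult: "noise \<rho> n (\<lambda>x. c * f x) (\<lambda>x. d * g x) = c * d * noise \<rho> n f g"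
  using noise_linear_left[of \<rho> n c f 0 f "\<lambda>x. d * g x"] noise_linear_right[of \<rho> n f d g 0 g]
  by simp

text \<open>Product rule at the last coordinate. Differentiating the weight
  \<open>(1 + \<rho> * s * t) / 4\<close> leaves \<open>s * t / 4\<close>, which by fact
  \<open>1\<close> yields the noise form of the derivatives in direction \<open>Suc n\<close>;
  differentiating the inner factor is the induction hypothesis.\<close>

lemma has_derivative_noise:
  "((\<lambda>\<rho>. noise \<rho> n f g) has_real_derivative
    (\<Sum>i=1..n. noise \<rho> n (dderiv i f) (dderiv i g))) (at \<rho>)"
proof (induction n arbitrary: f g)
  case (Suc n)
  let ?S = "slice (Suc n)"
  have 1: "noise \<rho> (Suc n) (dderiv (Suc n) f) (dderiv (Suc n) g)
     = (\<Sum>s\<in>{1, -1}. \<Sum>t\<in>{1, -1}. s * t / 4 * noise \<rho> n (?S s f) (?S t g))"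
    unfolding noise.simps slice_dderiv_same noise_linear_left noise_linear_right
    by (simp add: field_simps)
  have 2: "noise \<rho> (Suc n) (dderiv i f) (dderiv i g)
     = (\<Sum>s\<in>{1, -1}. \<Sum>t\<in>{1, -1}. (1 + \<rho> * s * t) / 4 * noise \<rho> n (dderiv i (?S s f)) (dderiv i (?S t g)))"
    if "i \<in> {1..n}" for i
    using that by (simp add: slice_dderiv)
  let ?D = "\<lambda>s t. \<Sum>i=1..n. noise \<rho> n (dderiv i (?S s f)) (dderiv i (?S t g))"
  have "(\<Sum>i=1..Suc n. noise \<rho> (Suc n) (dderiv i f) (dderiv i g))
     = (\<Sum>i=1..n. \<Sum>s\<in>{1, -1}. \<Sum>t\<in>{1, -1}. (1 + \<rho> * s * t) / 4 * noise \<rho> n (dderiv i (?S s f)) (dderiv i (?S t g)))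
       + (\<Sum>s\<in>{1, -1}. \<Sum>t\<in>{1, -1}. s * t / 4 * noise \<rho> n (?S s f) (?S t g))"
    using 1 2 by (simp del: noise.simps)
  also have "\<dots> = (\<Sum>s\<in>{1, -1}. \<Sum>t\<in>{1, -1}. (1 + \<rho> * s * t) / 4 * ?D s t + s * t / 4 * noise \<rho> n (?S s f) (?S t g))"
    by (simp add: sum.distrib sum_distrib_left)
  finally show ?case
    by (simp only: noise.simps(2)[of _ n f g]) (intro DERIV_sum, auto intro!: derivative_eq_intros Suc)
qed simp

section \<open>The entropic lower bound\<close>

text \<open>Jensen's inequality for the logarithm, from \<open>ln x \<le> x - 1\<close> at
  \<open>u i / q i / sum u I\<close>: the corrections \<open>u i / sum u I - q i\<close> add up to
  0.\<close>

lemma ln_sum_ge: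
  fixes q u :: "'a \<Rightarrow> real"
  assumes "finite I" "\<And>i. i \<in> I \<Longrightarrow> 0 \<le> q i" "sum q I = 1" "\<And>i. i \<in> I \<Longrightarrow> 0 \<le> u i"
    and pos: "\<And>i. i \<in> I \<Longrightarrow> 0 < q i \<Longrightarrow> 0 < u i"
  shows "0 < sum u I" "(\<Sum>i\<in>I. q i * ln (u i / q i)) \<le> ln (sum u I)"
proof -
  obtain i where i: "i \<in> I" "0 < q i"
    using assms(2,3) by (metis sum_nonpos not_less less_numeral_extra(1))
  then show S: "0 < sum u I"
    using assms(1,4) pos by (meson sum_pos2)
  have "q i * ln (u i / q i) \<le> q i * ln (sum u I) + (u i / sum u I - q i)" if "i \<in> I" for i
  proof (cases "q i = 0")
    case True
    then show ?thesis using that S assms(4) by simp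
  next
    case False
    then have q: "0 < q i" "0 < u i" using that assms(2) pos by force+
    have "ln (u i / q i) - ln (sum u I) = ln (u i / q i / sum u I)"
      using q S by (intro ln_divide_pos[symmetric]) auto
    also have "\<dots> \<le> u i / q i / sum u I - 1"
      using q S by (intro ln_le_minus_one) simp
    finally have "q i * (ln (u i / q i) - ln (sum u I)) \<le> q i * (u i / q i / sum u I - 1)"
      using q by (intro mult_left_mono) auto
    then show ?thesis using q by (simp add: algebra_simps)
  qed
  then have "(\<Sum>i\<in>I. q i * ln (u i / q i)) \<le> (\<Sum>i\<in>I. q i * ln (sum u I) + (u i / sum u I - q i))"
    by (rule sum_mono)
  also have "\<dots> = ln (sum u I)"
    using assms(3) S
    by (simp add: sum.distrib sum_subtractf flip: sum_distrib_right sum_divide_distrib)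
  finally show "(\<Sum>i\<in>I. q i * ln (u i / q i)) \<le> ln (sum u I)" .
qed

text \<open>The right side is the entropy of a sign of mean \<open>a\<close> relative to the uniform
  sign. The bound \<open>y * ln y \<ge> 2 * (y - sqrt y)\<close> reduces it to an estimate of
  \<open>sqrt (1 + a) + sqrt (1 - a)\<close>, obtained by squaring twice.\<close>

lemma bernoulli_entropy_ge:
  fixes a :: real
  assumes "\<bar>a\<bar> \<le> 1"
  shows "a\<^sup>2 / 4 \<le> ((1 + a) * ln (1 + a) + (1 - a) * ln (1 - a)) / 2"
proof -
  have *: "y * ln y \<ge> 2 * (y - sqrt y)" if "0 \<le> y" for y :: real
  proof (cases "y = 0")
    case False
    then have y: "0 < y" using that by simp
    have "ln (1 / sqrt y) \<le> 1 / sqrt y - 1"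
      using y by (intro ln_le_minus_one) simp
    then have "2 * (1 - 1 / sqrt y) \<le> ln y"
      using y by (simp add: ln_div ln_sqrt)
    then have "y * (2 * (1 - 1 / sqrt y)) \<le> y * ln y"
      using y by (intro mult_left_mono) auto
    moreover have "y * (2 * (1 - 1 / sqrt y)) = 2 * (y - y / sqrt y)" by (simp add: algebra_simps)
    ultimately show ?thesis using that by (simp add: real_div_sqrt)
  qed simp
  have "sqrt (1 + a) * sqrt (1 - a) = sqrt (1 - a\<^sup>2)"
    by (simp add: power2_eq_square algebra_simps flip: real_sqrt_mult)
  also have "\<dots> \<le> 1 - a\<^sup>2 / 2"
  proof (rule real_le_lsqrt)
    have "1 - a\<^sup>2 \<le> 1 - a\<^sup>2 + (a\<^sup>2 / 2)\<^sup>2" by simp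
    also have "\<dots> = (1 - a\<^sup>2 / 2)\<^sup>2" by (simp add: power2_diff)
    finally show "1 - a\<^sup>2 \<le> (1 - a\<^sup>2 / 2)\<^sup>2" .
    have "a\<^sup>2 \<le> 1" using assms by (simp add: abs_square_le_1)
    then show "0 \<le> 1 - a\<^sup>2 / 2" by simp
  qed
  finally have "(sqrt (1 + a) + sqrt (1 - a))\<^sup>2 \<le> 4 - a\<^sup>2"
    using assms by (simp add: power2_sum)
  also have "\<dots> \<le> 4 - a\<^sup>2 + (a\<^sup>2 / 4)\<^sup>2" by simp
  also have "\<dots> = (2 - a\<^sup>2 / 4)\<^sup>2" by (simp add: power2_diff)
  finally have "sqrt (1 + a) + sqrt (1 - a) \<le> 2 - a\<^sup>2 / 4"
    by (rule power2_le_imp_le) (use assms abs_square_le_1[of a] in simp)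
  then show ?thesis
    using *[of "1 + a"] *[of "1 - a"] assms by (simp add: abs_le_iff)
qed

text \<open>A coupling of two signs with means \<open>a\<close> and \<open>b\<close> whose covariance is at most \<open>\<rho>\<close> times the
  product of their standard deviations, and which is close in entropy to the \<open>\<rho>\<close>-correlated one.\<close>

definition coupling :: "real \<Rightarrow> real \<Rightarrow> real \<Rightarrow> real \<Rightarrow> real \<Rightarrow> real" where
  "coupling \<rho> a b s t = ((1 + a * s) * (1 + b * t) + \<rho> * (1 - a\<^sup>2) * (1 - b\<^sup>2) * s * t) / 4"

text \<open>As \<open>s\<close> and \<open>t\<close> square to 1, \<open>1 - a\<^sup>2\<close>
  splits as \<open>(1 + a * s) * (1 - a * s)\<close>. The product of the marginals comes out, and
  the last factor is what gets compared with \<open>1 + \<rho> * s * t\<close>.\<close>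

lemma coupling_factor:
  assumes "s = 1 \<or> s = -1" "t = 1 \<or> t = -1"
  shows "coupling \<rho> a b s t
    = (1 + a * s) * (1 + b * t) * (1 + \<rho> * s * t * (1 - a * s) * (1 - b * t)) / 4"
  using assms by (elim disjE) (simp_all add: coupling_def power2_eq_square algebra_simps)

text \<open>The factors \<open>1 - a * s\<close> and \<open>1 - b * t\<close> may both reach 2,
  whence the restriction to \<rho> at most 1/4.\<close>

lemma coupling_bounds:
  fixes \<rho> a b s t :: real
  assumes "0 \<le> \<rho>" "\<rho> \<le> 1/4" "\<bar>a\<bar> \<le> 1" "\<bar>b\<bar> \<le> 1" "s = 1 \<or> s = -1" "t = 1 \<or> t = -1"
  shows "0 \<le> 1 + a * s" "0 \<le> 1 + b * t" "0 \<le> 1 + \<rho> * s * t * (1 - a * s) * (1 - b * t)"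
proof -
  show "0 \<le> 1 + a * s" "0 \<le> 1 + b * t" using assms by auto
  have "\<bar>\<rho> * s * t * (1 - a * s) * (1 - b * t)\<bar> = \<rho> * (\<bar>1 - a * s\<bar> * \<bar>1 - b * t\<bar>)"
    using assms by (auto simp: abs_mult)
  also have "\<dots> \<le> 1/4 * (2 * 2)"
    using assms by (intro mult_mono) auto
  finally show "0 \<le> 1 + \<rho> * s * t * (1 - a * s) * (1 - b * t)" by (simp add: abs_le_iff)
qed

lemma coupling_nonneg:
  assumes "0 \<le> \<rho>" "\<rho> \<le> 1/4" "\<bar>a\<bar> \<le> 1" "\<bar>b\<bar> \<le> 1" "s = 1 \<or> s = -1" "t = 1 \<or> t = -1"
  shows "0 \<le> coupling \<rho> a b s t"
  unfolding coupling_factor[OF assms(5,6)]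
  using coupling_bounds[OF assms] by simp

lemma sum_coupling: "(\<Sum>s\<in>{1, -1}. \<Sum>t\<in>{1, -1}. coupling \<rho> a b s t) = 1"
  by (simp add: coupling_def field_simps)

text \<open>The balance for one revealed coordinate: the marginal entropies, weighted by
  \<open>8 * \<theta> * \<rho>\<close>, pay for the divergence of the coupling from the
  \<rho>-correlated law, the latter bounded through \<open>ln x \<le> x - 1\<close>.\<close>

lemma coupling_entropy:
  fixes \<rho> a b \<theta> :: real
  assumes \<rho>: "0 \<le> \<rho>" "\<rho> \<le> 1/4" and ab: "\<bar>a\<bar> \<le> 1" "\<bar>b\<bar> \<le> 1" and \<theta>: "\<theta> = \<rho> / (1 - \<rho>\<^sup>2)"
  shows "\<theta> * a * b + \<theta> * \<rho> / 2 * (a\<^sup>2 + b\<^sup>2) \<le>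
    (\<Sum>s\<in>{1, -1}. \<Sum>t\<in>{1, -1}. coupling \<rho> a b s t *
       (8 * \<theta> * \<rho> * (ln (1 + a * s) + ln (1 + b * t))
        - ((1 + \<rho> * s * t * (1 - a * s) * (1 - b * t)) / (1 + \<rho> * s * t) - 1)))"
    (is "_ \<le> ?R")
proof -
  define c where "c = \<rho> * (1 - a\<^sup>2) * (1 - b\<^sup>2)"
  have r: "\<rho>\<^sup>2 < 1" "1 + \<rho> > 0" "1 - \<rho> > 0" using \<rho> by (auto simp: abs_square_less_1)
  have \<theta>0: "0 \<le> \<theta>" using \<rho> r by (simp add: \<theta>)
  have q: "coupling \<rho> a b s t = ((1 + a * s) * (1 + b * t) + c * s * t) / 4" for s t
    by (simp add: coupling_def c_def)
  \<comment> \<open>Since \<open>(s * t)\<^sup>2 = 1\<close>, dividing by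
    \<open>1 + \<rho> * s * t\<close> means multiplying by
    \<open>(1 - \<rho> * s * t) / (1 - \<rho>\<^sup>2)\<close>; this dictates the choice of
    \<theta>.\<close>
  have R: "(1 + \<rho> * s * t * (1 - a * s) * (1 - b * t)) / (1 + \<rho> * s * t) - 1
      = \<theta> * (a * b - a * t - b * s) * (1 - \<rho> * s * t)"
    if "s \<in> {1, -1}" "t \<in> {1, -1}" for s t
  proof -
    have [simp]: "s * s = 1" "t * t = 1" "s * (s * z) = z" "t * (t * z) = z" for z
      using that by auto
    have "\<rho> * s * t * (1 - a * s) * (1 - b * t) = \<rho> * s * t + \<rho> * (a * b - a * t - b * s)"
      by (simp add: algebra_simps)
    moreover have p: "1 + \<rho> * s * t > 0" using that r by auto
    moreover have "(1 + \<rho> * s * t) * (1 - \<rho> * s * t) = 1 - \<rho>\<^sup>2"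
      by (simp add: algebra_simps power2_eq_square)
    then have "\<theta> * (1 - \<rho> * s * t) = \<rho> / (1 + \<rho> * s * t)"
      unfolding \<theta> using p r by (simp add: field_simps)
    ultimately have "\<theta> * (1 - \<rho> * s * t) * (a * b - a * t - b * s)
        = (1 + \<rho> * s * t * (1 - a * s) * (1 - b * t)) / (1 + \<rho> * s * t) - 1"
      by (simp add: add_divide_distrib flip: add.assoc)
    then show ?thesis by (simp only: mult_ac)
  qed
  have "?R = 8 * \<theta> * \<rho> * (((1 + a) * ln (1 + a) + (1 - a) * ln (1 - a)) / 2
                       + ((1 + b) * ln (1 + b) + (1 - b) * ln (1 - b)) / 2)
             - \<theta> * (\<rho> * (a\<^sup>2 + b\<^sup>2 - a * b * (a * b + c)) - a * b)"
    unfolding q by (simp only: R cong: sum.cong) (simp add: field_simps power2_eq_square)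
  \<comment> \<open>The constant 8 yields two copies of
    \<open>\<theta> * \<rho> * (a\<^sup>2 + b\<^sup>2)\<close>. One covers the subtracted squares,
    half of the other absorbs \<open>a * b * c\<close>, and the last half remains for the
    claim.\<close>
  also have "\<dots> \<ge> 8 * \<theta> * \<rho> * (a\<^sup>2 / 4 + b\<^sup>2 / 4) - \<theta> * (\<rho> * (a\<^sup>2 + b\<^sup>2 - a * b * (a * b + c)) - a * b)"
    using bernoulli_entropy_ge[OF ab(1)] bernoulli_entropy_ge[OF ab(2)] \<theta>0 \<rho>
    by (intro diff_right_mono mult_left_mono add_mono) auto
  also have "8 * \<theta> * \<rho> * (a\<^sup>2 / 4 + b\<^sup>2 / 4) - \<theta> * (\<rho> * (a\<^sup>2 + b\<^sup>2 - a * b * (a * b + c)) - a * b)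
      = \<theta> * a * b + \<theta> * \<rho> * (a\<^sup>2 + b\<^sup>2 + (a * b)\<^sup>2 + a * b * c)"
    by (simp add: algebra_simps power2_eq_square)
  finally have 1: "\<theta> * a * b + \<theta> * \<rho> * (a\<^sup>2 + b\<^sup>2 + (a * b)\<^sup>2 + a * b * c) \<le> ?R" .
  have "\<bar>c\<bar> \<le> 1 * 1 * 1"
    unfolding c_def abs_mult using \<rho> ab by (intro mult_mono) (auto simp: abs_square_le_1)
  then have "\<bar>a * b * c\<bar> \<le> \<bar>a\<bar> * \<bar>b\<bar>"
    by (simp add: abs_mult mult_left_le)
  also have "\<dots> \<le> (a\<^sup>2 + b\<^sup>2) / 2"
    using sum_squares_bound[of "\<bar>a\<bar>" "\<bar>b\<bar>"] by simp
  finally have "- (a * b * c) \<le> (a\<^sup>2 + b\<^sup>2) / 2"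
    by (rule order_trans[OF abs_ge_minus_self])
  then have "(a\<^sup>2 + b\<^sup>2) / 2 \<le> a\<^sup>2 + b\<^sup>2 + (a * b)\<^sup>2 + a * b * c"
    using add_increasing2[OF zero_le_power2[of "a * b"]] by (smt (verit) field_sum_of_halves zero_le_power2)
  then have "\<theta> * \<rho> * ((a\<^sup>2 + b\<^sup>2) / 2) \<le> \<theta> * \<rho> * (a\<^sup>2 + b\<^sup>2 + (a * b)\<^sup>2 + a * b * c)"
    using \<theta>0 \<rho> by (intro mult_left_mono) auto
  with 1 show ?thesis by simp
qed

text \<open>Under the coupling \<open>u s\<close> and \<open>v t\<close> have means
  \<open>u'\<close> and \<open>v'\<close>, variances \<open>A * d\<^sup>2\<close> and
  \<open>B * e\<^sup>2\<close>, and covariance \<open>\<rho> * A * B * d * e\<close>. The variances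
  gained by the squares outweigh a negative covariance, which is why squares accompany the
  product.\<close>

lemma coupling_quadratic:
  fixes \<rho> a b \<theta> :: real and u v :: "real \<Rightarrow> real"
  assumes \<rho>: "0 \<le> \<rho>" and \<theta>: "0 \<le> \<theta>" and ab: "\<bar>a\<bar> \<le> 1" "\<bar>b\<bar> \<le> 1"
    and u': "u' = (1 + a) / 2 * u 1 + (1 - a) / 2 * u (-1)"
    and v': "v' = (1 + b) / 2 * v 1 + (1 - b) / 2 * v (-1)"
  shows "\<theta> * u' * v' + \<theta> * \<rho> / 2 * (u'\<^sup>2 + v'\<^sup>2) \<le>
    (\<Sum>s\<in>{1, -1}. \<Sum>t\<in>{1, -1}. coupling \<rho> a b s t *
       (\<theta> * u s * v t + \<theta> * \<rho> / 2 * ((u s)\<^sup>2 + (v t)\<^sup>2)))" (is "?L \<le> ?R")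
proof -
  define d e where "d = (u 1 - u (-1)) / 2" and "e = (v 1 - v (-1)) / 2"
  define A B where "A = 1 - a\<^sup>2" and "B = 1 - b\<^sup>2"
  have AB: "0 \<le> A" "A \<le> 1" "0 \<le> B" "B \<le> 1"
    using ab by (auto simp: A_def B_def abs_square_le_1)
  have u: "u 1 = u' + (1 - a) * d" "u (-1) = u' - (1 + a) * d"
    and v: "v 1 = v' + (1 - b) * e" "v (-1) = v' - (1 + b) * e"
    by (simp_all add: u' v' d_def e_def field_simps)
  have "?R - ?L = \<theta> * \<rho> * (A * B * (d * e) + (A * d\<^sup>2 + B * e\<^sup>2) / 2)"
    by (simp add: coupling_def u v A_def B_def field_simps power2_eq_square)
  moreover have "0 \<le> A * B * (d * e) + (A * d\<^sup>2 + B * e\<^sup>2) / 2"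
  proof -
    have "A * B * d\<^sup>2 \<le> A * d\<^sup>2" "A * B * e\<^sup>2 \<le> B * e\<^sup>2"
      using AB by (auto intro!: mult_right_mono simp: mult_left_le mult_left_le_one_le)
    then have "A * B * d\<^sup>2 + A * B * e\<^sup>2 + 2 * (A * B * (d * e)) \<le> A * d\<^sup>2 + B * e\<^sup>2 + 2 * (A * B * (d * e))"
      by (intro add_mono order_refl)
    moreover have "A * B * d\<^sup>2 + A * B * e\<^sup>2 + 2 * (A * B * (d * e)) = A * B * (d + e)\<^sup>2"
      by (simp add: power2_sum algebra_simps)
    moreover have "0 \<le> A * B * (d + e)\<^sup>2" using AB by simp
    ultimately have "0 \<le> A * d\<^sup>2 + B * e\<^sup>2 + 2 * (A * B * (d * e))" by (simp only:)
    then show ?thesis by (simp add: field_simps)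
  qed
  ultimately have "0 \<le> ?R - ?L" using \<rho> \<theta> by (metis mult_nonneg_nonneg)
  then show ?thesis by (simp only: diff_ge_0_iff_ge)
qed

section \<open>Coordinate means of the uniform law on the support of a 0/1-valued function\<close>

definition mean :: "nat \<Rightarrow> ((nat \<Rightarrow> real) \<Rightarrow> real) \<Rightarrow> nat \<Rightarrow> real" where
  "mean n f j = expect n (\<lambda>x. f x * x j) / expect n f"

text \<open>Covers null slices: there \<open>mean\<close> is 0 by division by zero, and
  \<open>expect * mean\<close> still gives the right value.\<close>

lemma expect_mult_coord_eq_0:
  assumes "f \<in> cube n \<rightarrow> {0, 1}" "expect n f = 0"
  shows "expect n (\<lambda>x. f x * x j) = 0"
proof -
  have "\<forall>x\<in>cube n. f x = 0"
    using assms by (subst expect_eq_0_iff[symmetric]) (auto dest: Pi_mem)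
  then have "expect n (\<lambda>x. f x * x j) = expect n (\<lambda>_. 0)"
    by (intro expect_cong) simp
  then show ?thesis by simp
qed

lemma slice_in_cube:
  "f \<in> cube (Suc n) \<rightarrow> A \<Longrightarrow> s = 1 \<or> s = -1 \<Longrightarrow> slice (Suc n) s f \<in> cube n \<rightarrow> A"
  using fun_upd_cube_Suc by (auto simp: slice_def Pi_iff)

text \<open>On the support, the last sign is \<open>s\<close> with probability
  \<open>(1 + a * s) / 2\<close>, where \<open>a\<close> is its mean. Nonnegativity of both slice
  masses bounds \<open>a\<close>.\<close>

lemma mean_last:
  assumes "f \<in> cube (Suc n) \<rightarrow> {0, 1}" "0 < expect (Suc n) f"
  shows "s = 1 \<or> s = -1 \<Longrightarrow> expect n (slice (Suc n) s f) = expect (Suc n) f * (1 + mean (Suc n) f (Suc n) * s)"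
    and "\<bar>mean (Suc n) f (Suc n)\<bar> \<le> 1"
proof -
  have "slice (Suc n) s (\<lambda>x. f x * x (Suc n)) = (\<lambda>x. s * slice (Suc n) s f x)" for s
    by (auto simp: slice_def)
  then have m: "mean (Suc n) f (Suc n)
      = (expect n (slice (Suc n) 1 f) - expect n (slice (Suc n) (-1) f)) / 2 / expect (Suc n) f"
    unfolding mean_def expect_Suc[of n "\<lambda>x. f x * x (Suc n)"] by (simp only: expect_cmult) simp
  have nn: "0 \<le> expect n (slice (Suc n) s f)" if "s = 1 \<or> s = -1" for s
    using slice_in_cube[OF assms(1) that] by (intro expect_nonneg) (auto dest: Pi_mem)
  show *: "expect n (slice (Suc n) s f) = expect (Suc n) f * (1 + mean (Suc n) f (Suc n) * s)"
    if "s = 1 \<or> s = -1" for s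
    using that assms(2) unfolding m by (auto simp: expect_Suc field_simps)
  have "0 \<le> 1 + mean (Suc n) f (Suc n) * s" if "s = 1 \<or> s = -1" for s
    using nn[OF that] assms(2) unfolding *[OF that] by (simp add: zero_le_mult_iff)
  from this[of 1] this[of "-1"] show "\<bar>mean (Suc n) f (Suc n)\<bar> \<le> 1" by simp
qed

text \<open>Total expectation over the last sign; this is the hypothesis on \<open>u'\<close> and
  \<open>v'\<close> in \<open>coupling_quadratic\<close>.\<close>

lemma mean_other:
  assumes f: "f \<in> cube (Suc n) \<rightarrow> {0, 1}" "0 < expect (Suc n) f" and "j \<in> {1..n}"
  defines "a \<equiv> mean (Suc n) f (Suc n)"
  shows "mean (Suc n) f j
    = (1 + a) / 2 * mean n (slice (Suc n) 1 f) j + (1 - a) / 2 * mean n (slice (Suc n) (-1) f) j"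
proof -
  have "slice (Suc n) s (\<lambda>x. f x * x j) = (\<lambda>x. slice (Suc n) s f x * x j)" for s
    using assms(3) by (auto simp: slice_def)
  moreover have "expect n (\<lambda>x. slice (Suc n) s f x * x j)
      = expect (Suc n) f * (1 + a * s) * mean n (slice (Suc n) s f) j" if "s = 1 \<or> s = -1" for s
    using expect_mult_coord_eq_0[OF slice_in_cube[OF f(1) that]] mean_last(1)[OF f that]
    by (cases "expect n (slice (Suc n) s f) = 0") (auto simp: mean_def a_def)
  ultimately have "expect (Suc n) (\<lambda>x. f x * x j) = expect (Suc n) f *
     ((1 + a) / 2 * mean n (slice (Suc n) 1 f) j + (1 - a) / 2 * mean n (slice (Suc n) (-1) f) j)"
    unfolding expect_Suc[of n "\<lambda>x. f x * x j"] by (simp add: field_simps)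
  then show ?thesis using f(2) unfolding mean_def[of "Suc n"] by simp
qed

text \<open>By Gibbs' variational principle, \<open>ln (noise \<rho> n f g)\<close> is at least minus the entropy,
  relative to the \<open>\<rho>\<close>-correlated law, of any coupling of the uniform laws on the supports of \<open>f\<close>
  and \<open>g\<close>.  Here the coordinates
  are revealed one by one and joined by \<open>coupling\<close>; the squared means make the induction close.\<close>

lemma ln_noise_ge:
  fixes \<rho> \<theta> :: real
  assumes \<rho>: "0 \<le> \<rho>" "\<rho> \<le> 1/4" and \<theta>: "\<theta> = \<rho> / (1 - \<rho>\<^sup>2)"
    and "f \<in> cube n \<rightarrow> {0, 1}" "g \<in> cube n \<rightarrow> {0, 1}" "0 < expect n f" "0 < expect n g"
  shows "0 < noise \<rho> n f g \<and>
    (1 + 8 * \<theta> * \<rho>) * (ln (expect n f) + ln (expect n g)) +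
      (\<Sum>j=1..n. \<theta> * mean n f j * mean n g j + \<theta> * \<rho> / 2 * ((mean n f j)\<^sup>2 + (mean n g j)\<^sup>2))
    \<le> ln (noise \<rho> n f g)"
  using assms(4-7)
proof (induction n arbitrary: f g)
  case 0
  then show ?case by (auto simp: cube_0)
next
  case (Suc n)
  define \<alpha> \<beta> a b where "\<alpha> = expect (Suc n) f" and "\<beta> = expect (Suc n) g"
    and "a = mean (Suc n) f (Suc n)" and "b = mean (Suc n) g (Suc n)"
  define K where "K = 8 * \<theta> * \<rho>"
  let ?F = "\<lambda>s. slice (Suc n) s f" and ?G = "\<lambda>t. slice (Suc n) t g"
  let ?P = "\<lambda>u v. \<theta> * u * v + \<theta> * \<rho> / 2 * (u\<^sup>2 + v\<^sup>2)"
  let ?q = "coupling \<rho> a b" and ?h = "\<lambda>s t. noise \<rho> n (?F s) (?G t)"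
  define M where "M s t = (\<Sum>j=1..n. ?P (mean n (?F s) j) (mean n (?G t) j))" for s t
  let ?R = "\<lambda>s t. (1 + \<rho> * s * t * (1 - a * s) * (1 - b * t)) / (1 + \<rho> * s * t)"
  have \<theta>0: "0 \<le> \<theta>" using \<rho> by (auto simp: \<theta> abs_square_le_1)
  have pos: "0 < \<alpha>" "0 < \<beta>" using Suc.prems by (auto simp: \<alpha>_def \<beta>_def)
  have ab: "\<bar>a\<bar> \<le> 1" "\<bar>b\<bar> \<le> 1"
    using mean_last(2) Suc.prems by (auto simp: a_def b_def)
  have q0: "0 \<le> ?q s t" if "s \<in> {1, -1}" "t \<in> {1, -1}" for s t
    using that coupling_nonneg[OF \<rho> ab] by auto
  \<comment> \<open>The induction hypothesis for a pair of slices of positive mass gives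
    \<open>1 + K\<close> copies of \<open>ln (1 + a * s)\<close> and \<open>ln (1 + b * t)\<close>.
    Dividing by the coupling removes one copy of each, leaving \<open>K\<close> for
    \<open>coupling_entropy\<close>.\<close>
  have step: "0 < ?h s t"
    "(1 + K) * (ln \<alpha> + ln \<beta>) + (K * (ln (1 + a * s) + ln (1 + b * t)) - (?R s t - 1)) + M s t
       \<le> ln ((1 + \<rho> * s * t) / 4 * ?h s t / ?q s t)"
    if st: "s \<in> {1, -1}" "t \<in> {1, -1}" and q: "0 < ?q s t" for s t
  proof -
    have st': "s = 1 \<or> s = -1" "t = 1 \<or> t = -1" using st by auto
    note fact = coupling_factor[OF st', of \<rho> a b]
    have p: "0 < 1 + a * s" "0 < 1 + b * t" "0 < 1 + \<rho> * s * t * (1 - a * s) * (1 - b * t)"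
      using q coupling_bounds[OF \<rho> ab st'] unfolding fact by (auto simp: less_le)
    have r: "0 < 1 + \<rho> * s * t" using \<rho> st' by auto
    have R: "0 < ?R s t" using p r by simp
    have E: "expect n (?F s) = \<alpha> * (1 + a * s)" "expect n (?G t) = \<beta> * (1 + b * t)"
      using mean_last(1)[of f n s] mean_last(1)[of g n t] Suc.prems st'
      by (auto simp: \<alpha>_def \<beta>_def a_def b_def)
    have *: "0 < ?h s t \<and> (1 + K) * (ln (\<alpha> * (1 + a * s)) + ln (\<beta> * (1 + b * t))) + M s t \<le> ln (?h s t)"
      using Suc.IH[of "?F s" "?G t"] Suc.prems slice_in_cube st' pos p
      unfolding E K_def M_def by auto
    then show h: "0 < ?h s t" ..
    have "(1 + \<rho> * s * t) / 4 * ?h s t / ?q s t = ?h s t / ((1 + a * s) * ((1 + b * t) * ?R s t))"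
      unfolding fact using p r by (simp add: mult.assoc mult.commute)
    also have "ln \<dots> = ln (?h s t) - (ln (1 + a * s) + (ln (1 + b * t) + ln (?R s t)))"
      using h p R by (simp only: ln_divide_pos[of "?h s t"] ln_mult_pos mult_pos_pos)
    finally have "ln ((1 + \<rho> * s * t) / 4 * ?h s t / ?q s t) = \<dots>" .
    moreover have "ln (?R s t) \<le> ?R s t - 1" using R by (rule ln_le_minus_one)
    moreover have "ln (\<alpha> * (1 + a * s)) = ln \<alpha> + ln (1 + a * s)" "ln (\<beta> * (1 + b * t)) = ln \<beta> + ln (1 + b * t)"
      using pos p by (simp_all add: ln_mult_pos)
    ultimately show "(1 + K) * (ln \<alpha> + ln \<beta>) + (K * (ln (1 + a * s) + ln (1 + b * t)) - (?R s t - 1)) + M s t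
       \<le> ln ((1 + \<rho> * s * t) / 4 * ?h s t / ?q s t)"
      using * by (simp add: algebra_simps)
  qed
  let ?I = "{1, -1} \<times> {1, -1 :: real}"
  have *: "0 < (\<Sum>(s, t)\<in>?I. (1 + \<rho> * s * t) / 4 * ?h s t)"
    "(\<Sum>(s, t)\<in>?I. ?q s t * ln ((1 + \<rho> * s * t) / 4 * ?h s t / ?q s t))
       \<le> ln (\<Sum>(s, t)\<in>?I. (1 + \<rho> * s * t) / 4 * ?h s t)"
  proof -
    let ?u = "\<lambda>(s, t). (1 + \<rho> * s * t) / 4 * ?h s t"
    have h0: "0 \<le> ?h s t" if "s \<in> {1, -1}" "t \<in> {1, -1}" for s t
    proof (rule noise_nonneg)
      show "\<bar>\<rho>\<bar> \<le> 1" using \<rho> by simp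
      show "0 \<le> ?F s x" "0 \<le> ?G t x" if "x \<in> cube n" for x
        using that \<open>s \<in> {1, -1}\<close> \<open>t \<in> {1, -1}\<close> Pi_mem[OF slice_in_cube[OF Suc.prems(1), of s]]
          Pi_mem[OF slice_in_cube[OF Suc.prems(2), of t]] by fastforce+
    qed
    have 1: "finite ?I" "\<And>i. i \<in> ?I \<Longrightarrow> 0 \<le> (\<lambda>(s, t). ?q s t) i" "sum (\<lambda>(s, t). ?q s t) ?I = 1"
      "\<And>i. i \<in> ?I \<Longrightarrow> 0 \<le> ?u i"
      "\<And>i. i \<in> ?I \<Longrightarrow> 0 < (\<lambda>(s, t). ?q s t) i \<Longrightarrow> 0 < ?u i"
      subgoal by simp
      subgoal using q0 by auto
      subgoal using sum_coupling by (simp only: sum.cartesian_product)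
      subgoal using \<rho> h0 by (auto intro!: mult_nonneg_nonneg)
      subgoal using \<rho> step(1) by (auto intro!: mult_pos_pos)
      done
    show "0 < (\<Sum>(s, t)\<in>?I. (1 + \<rho> * s * t) / 4 * ?h s t)"
      by (rule ln_sum_ge(1)[OF 1])
    show "(\<Sum>(s, t)\<in>?I. ?q s t * ln ((1 + \<rho> * s * t) / 4 * ?h s t / ?q s t))
       \<le> ln (\<Sum>(s, t)\<in>?I. (1 + \<rho> * s * t) / 4 * ?h s t)"
      using ln_sum_ge(2)[OF 1] by (simp only: split_def)
  qed
  have noise: "noise \<rho> (Suc n) f g = (\<Sum>(s, t)\<in>?I. (1 + \<rho> * s * t) / 4 * ?h s t)"
    by (simp only: noise.simps sum.cartesian_product)
  have "(1 + K) * (ln \<alpha> + ln \<beta>) + (\<Sum>j=1..Suc n. ?P (mean (Suc n) f j) (mean (Suc n) g j))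
     = (1 + K) * (ln \<alpha> + ln \<beta>) + ?P a b + (\<Sum>j=1..n. ?P (mean (Suc n) f j) (mean (Suc n) g j))"
    by (simp add: a_def b_def)
  \<comment> \<open>Three separate bounds: the coupling has total mass 1,
    \<open>coupling_entropy\<close> treats the new coordinate, and \<open>coupling_quadratic\<close>
    treats each earlier one.\<close>
  also have "\<dots> \<le> (1 + K) * (ln \<alpha> + ln \<beta>) * (\<Sum>s\<in>{1, -1}. \<Sum>t\<in>{1, -1}. ?q s t)
     + (\<Sum>s\<in>{1, -1}. \<Sum>t\<in>{1, -1}. ?q s t * (K * (ln (1 + a * s) + ln (1 + b * t)) - (?R s t - 1)))
     + (\<Sum>j=1..n. \<Sum>s\<in>{1, -1}. \<Sum>t\<in>{1, -1}. ?q s t * ?P (mean n (?F s) j) (mean n (?G t) j))"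
    unfolding K_def
    by (intro add_mono sum_mono coupling_entropy[OF \<rho> ab \<theta>] coupling_quadratic[OF \<rho>(1) \<theta>0 ab]
         mean_other[of f n, folded a_def] mean_other[of g n, folded b_def])
       (use Suc.prems in \<open>simp_all add: sum_coupling del: sum.insert\<close>)
  also have "\<dots> = (\<Sum>s\<in>{1, -1}. \<Sum>t\<in>{1, -1}. ?q s t *
      ((1 + K) * (ln \<alpha> + ln \<beta>) + (K * (ln (1 + a * s) + ln (1 + b * t)) - (?R s t - 1)) + M s t))"
  proof -
    have "(\<Sum>j=1..n. \<Sum>s\<in>{1, -1}. \<Sum>t\<in>{1, -1}. ?q s t * ?P (mean n (?F s) j) (mean n (?G t) j))
       = (\<Sum>s\<in>{1, -1}. \<Sum>t\<in>{1, -1}. ?q s t * M s t)"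
      unfolding M_def sum_distrib_left by (subst sum.swap, intro sum.cong refl sum.swap)
    then show ?thesis
      by (simp only: distrib_left sum.distrib sum_distrib_left mult.commute)
  qed
  also have "\<dots> \<le> (\<Sum>s\<in>{1, -1}. \<Sum>t\<in>{1, -1}. ?q s t * ln ((1 + \<rho> * s * t) / 4 * ?h s t / ?q s t))"
  proof (intro sum_mono)
    fix s t :: real assume st: "s \<in> {1, -1}" "t \<in> {1, -1}"
    show "?q s t * ((1 + K) * (ln \<alpha> + ln \<beta>) + (K * (ln (1 + a * s) + ln (1 + b * t)) - (?R s t - 1)) + M s t)
      \<le> ?q s t * ln ((1 + \<rho> * s * t) / 4 * ?h s t / ?q s t)"
      using q0[OF st] step(2)[OF st] by (cases "?q s t = 0") (auto intro!: mult_left_mono)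
  qed
  also have "\<dots> \<le> ln (noise \<rho> (Suc n) f g)"
    using *(2) unfolding noise by (simp only: sum.cartesian_product)
  finally show ?case
    using *(1) noise by (simp add: K_def \<alpha>_def \<beta>_def)
qed

section \<open>Integration over the noise\<close>

lemma continuous_on_noise: "continuous_on S (\<lambda>\<rho>. noise \<rho> n f g)"
  by (rule DERIV_continuous_on, rule has_field_derivative_at_within, rule has_derivative_noise)

lemma Cor_eq_integral:
  "Cor n f g = (\<Sum>i=1..n. integral {0..1} (\<lambda>\<rho>. noise \<rho> n (dderiv i f) (dderiv i g)))"
proof -
  have "((\<lambda>\<rho>. \<Sum>i=1..n. noise \<rho> n (dderiv i f) (dderiv i g)) has_integral
      noise 1 n f g - noise 0 n f g) {0..1}"
    using has_derivative_noise
    by (intro fundamental_theorem_of_calculus)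
       (auto simp: has_real_derivative_iff_has_vector_derivative intro: has_vector_derivative_at_within)
  then have "Cor n f g = integral {0..1} (\<lambda>\<rho>. \<Sum>i=1..n. noise \<rho> n (dderiv i f) (dderiv i g))"
    by (simp add: Cor_def noise_0 noise_1 integral_unique)
  also have "\<dots> = (\<Sum>i=1..n. integral {0..1} (\<lambda>\<rho>. noise \<rho> n (dderiv i f) (dderiv i g)))"
    by (intro integral_sum integrable_continuous_interval continuous_on_noise) auto
  finally show ?thesis .
qed

lemma integral_noise_ge:
  assumes "\<And>x. x \<in> cube n \<Longrightarrow> 0 \<le> f x" "\<And>x. x \<in> cube n \<Longrightarrow> 0 \<le> g x"
    and "0 \<le> \<tau>" "\<tau> \<le> 1" "\<And>\<rho>. 0 \<le> \<rho> \<Longrightarrow> \<rho> \<le> \<tau> \<Longrightarrow> m \<le> noise \<rho> n f g"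
  shows "\<tau> * m \<le> integral {0..1} (\<lambda>\<rho>. noise \<rho> n f g)"
proof -
  have int: "(\<lambda>\<rho>. noise \<rho> n f g) integrable_on {0..t}" for t
    by (intro integrable_continuous_interval continuous_on_noise)
  have "\<tau> * m = integral {0..\<tau>} (\<lambda>_. m)"
    using assms(3) by simp
  also have "\<dots> \<le> integral {0..\<tau>} (\<lambda>\<rho>. noise \<rho> n f g)"
    using assms(5) by (intro integral_le int) auto
  also have "\<dots> \<le> integral {0..1} (\<lambda>\<rho>. noise \<rho> n f g)"
    using assms(1,2,4) by (intro integral_subset_le int) (auto intro!: noise_nonneg)
  finally show ?thesis .
qed

text \<open>With \<mu> the minimum in the summand, the integrand is at least
  \<open>p * exp (- 3) / 4\<close> on an interval of length \<open>\<mu> / 4\<close>; the product is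
  the claimed bound.\<close>

lemma corr_term_le_integral:
  fixes n i :: nat and f g :: "(nat \<Rightarrow> real) \<Rightarrow> real"
  defines "p \<equiv> influence n i f * influence n i g"
    and "s \<equiv> dot n (Vvec n i f) (Vvec n i g)"
  assumes "i \<in> {1..n}" "f \<in> cube n \<rightarrow> {0, 1}" "g \<in> cube n \<rightarrow> {0, 1}"
    and "cube_increasing n f" "cube_increasing n g"
  shows "exp (- 3) / 16 * corr_term p s \<le> integral {0..1} (\<lambda>\<rho>. noise \<rho> n (dderiv i f) (dderiv i g))"
proof -
  \<comment> \<open>Doubling makes the derivatives of increasing 0/1-valued functions 0/1-valued
    again, as \<open>ln_noise_ge\<close> requires.\<close>
  define F G where "F = (\<lambda>x. 2 * dderiv i f x)" and "G = (\<lambda>x. 2 * dderiv i g x)"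
  have D: "0 \<le> dderiv i h x" "2 * dderiv i h x \<in> {0, 1}"
    if "h \<in> cube n \<rightarrow> {0, 1}" "cube_increasing n h" "x \<in> cube n" for h x
  proof -
    show "0 \<le> dderiv i h x" using that assms(3) by (auto simp: cube_increasing_def)
    moreover have "h (x(i := 1)) \<in> {0, 1}" "h (x(i := -1)) \<in> {0, 1}"
      using that assms(3) fun_upd_cube by (auto intro!: Pi_mem[of h])
    ultimately show "2 * dderiv i h x \<in> {0, 1}" by (auto simp: dderiv_def)
  qed
  have FG: "F \<in> cube n \<rightarrow> {0, 1}" "G \<in> cube n \<rightarrow> {0, 1}"
    using D(2) assms(4-7) by (auto simp: F_def G_def)
  have infl: "influence n i h = expect n (\<lambda>x. 2 * dderiv i h x)"
    if "h \<in> cube n \<rightarrow> {0, 1}" "cube_increasing n h" for h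
    using D(1)[OF that] unfolding influence_def expect_cmult by (auto intro!: expect_cong)
  have p: "p = expect n F * expect n G"
    using infl assms(4-7) by (simp add: p_def F_def G_def)
  have range: "0 \<le> expect n H" "expect n H \<le> 1" if "H \<in> cube n \<rightarrow> {0, 1}" for H
  proof -
    have "0 \<le> H x \<and> H x \<le> 1" if "x \<in> cube n" for x
      using Pi_mem[OF \<open>H \<in> _\<close> that] by auto
    then show "0 \<le> expect n H" "expect n H \<le> 1"
      using expect_mono[of n H "\<lambda>_. 1"] by (auto intro: expect_nonneg)
  qed
  have nn: "0 \<le> dderiv i f x" "0 \<le> dderiv i g x" if "x \<in> cube n" for x
    using D(1) that assms(4-7) by auto
  show ?thesis
  proof (cases "p = 0")
    case True
    then show ?thesis
      using integral_noise_ge[of n "dderiv i f" "dderiv i g" 0 0] nn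
      by (simp add: corr_term_def noise_0 expect_nonneg)
  next
    case False
    have pos: "0 < expect n F" "0 < expect n G"
      using False range FG by (auto simp: p less_le)
    have p01: "0 < p" "p \<le> 1"
      using pos range FG by (auto simp: p intro!: mult_le_one)
    have V: "Vvec n i h j = expect n (\<lambda>x. 2 * dderiv i h x * x j) / 2" if "j \<in> {1..n}" for h j
      using expect_cmult[of n 2 "\<lambda>x. dderiv i h x * x j"]
      by (simp add: Vvec_def expect_dderiv[OF that] mult.assoc)
    \<comment> \<open>Each \<open>Vvec\<close> component is half of a first-order coefficient of
      \<open>F\<close> or \<open>G\<close>; the two halves produce the factor 4.\<close>
    have s: "(\<Sum>j=1..n. mean n F j * mean n G j) = 4 * s / p"
      unfolding s_def dot_def p F_def G_def mean_def sum_distrib_left sum_divide_distrib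
      by (intro sum.cong) (auto simp: V)
    define l where "l = ln (exp 1 / p)"
    have l: "l = 1 - ln p" "1 \<le> l"
      using p01 by (simp_all add: l_def ln_divide_pos)
    define \<mu> where "\<mu> = (if s = 0 then 1 / sqrt l else min (1 / sqrt l) (p / \<bar>s\<bar>))"
    have ct: "corr_term p s = p * \<mu>"
      using False by (simp add: corr_term_def \<mu>_def l_def)
    have \<mu>: "0 \<le> \<mu>" "\<mu> \<le> 1 / sqrt l" "\<mu> \<le> 1" "\<mu> * \<bar>s\<bar> \<le> p"
    proof -
      show "0 \<le> \<mu>" using p01 l(2) by (auto simp: \<mu>_def)
      show "\<mu> \<le> 1 / sqrt l" by (simp add: \<mu>_def)
      also have "1 / sqrt l \<le> 1" using l(2) by simp
      finally show "\<mu> \<le> 1" .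
      show "\<mu> * \<bar>s\<bar> \<le> p"
      proof (cases "s = 0")
        case False
        then have "\<mu> * \<bar>s\<bar> \<le> p / \<bar>s\<bar> * \<bar>s\<bar>"
          by (intro mult_right_mono) (auto simp: \<mu>_def)
        with False show ?thesis by simp
      qed (use p01 in simp)
    qed
    have \<mu>2: "\<mu>\<^sup>2 * l \<le> 1"
    proof -
      have "\<mu>\<^sup>2 \<le> (1 / sqrt l)\<^sup>2" using \<mu> by (intro power_mono) auto
      also have "(1 / sqrt l)\<^sup>2 = 1 / l" using l(2) by (simp add: power_divide)
      finally show ?thesis using l(2) pos_le_divide_eq[of l "\<mu>\<^sup>2" 1] by linarith
    qed
    \<comment> \<open>Here \<theta> is at most \<open>2 * \<rho>\<close>, hence at most
      \<open>\<mu> / 2\<close>. The entropy term then costs at most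
      \<open>\<mu>\<^sup>2 * l \<le> 1\<close> and the linear term at most
      \<open>2 * \<mu> * \<bar>s\<bar> / p \<le> 2\<close>: together 3 in the exponent.\<close>
    have main: "p * exp (- 3) / 4 \<le> noise \<rho> n (dderiv i f) (dderiv i g)" if \<rho>: "0 \<le> \<rho>" "\<rho> \<le> \<mu> / 4" for \<rho>
    proof -
      define \<theta> where "\<theta> = \<rho> / (1 - \<rho>\<^sup>2)"
      have \<rho>4: "\<rho> \<le> 1/4" using \<rho> \<mu> by simp
      have "\<rho>\<^sup>2 \<le> (1/4)\<^sup>2" using \<rho> \<rho>4 by (intro power_mono) auto
      then have r: "1/2 \<le> 1 - \<rho>\<^sup>2" by (simp add: power2_eq_square)
      have \<theta>: "0 \<le> \<theta>" "\<theta> \<le> 2 * \<rho>"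
        using \<rho> r mult_left_mono[OF r, of "2 * \<rho>"] by (auto simp: \<theta>_def field_simps)
      have "\<theta> * \<rho> * (l - 1) \<le> 1/8"
      proof -
        have "\<theta> * \<rho> * (l - 1) \<le> (2 * (\<mu> / 4)) * (\<mu> / 4) * l"
          using \<theta> \<rho> l by (intro mult_mono) auto
        also have "\<dots> = \<mu>\<^sup>2 * l / 8" by (simp add: power2_eq_square)
        finally show ?thesis using \<mu>2 by simp
      qed
      then have e1: "- 1 \<le> 8 * \<theta> * \<rho> * ln p" by (simp add: l(1))
      have e2: "- 2 \<le> \<theta> * (4 * s / p)"
      proof -
        have "\<bar>\<theta> * (4 * s / p)\<bar> = 4 * \<theta> * (\<bar>s\<bar> / p)"
          using \<theta> p01 by (simp add: abs_mult)
        also have "\<dots> \<le> 4 * (2 * (\<mu> / 4)) * (\<bar>s\<bar> / p)"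
          using \<theta> \<rho> p01 by (intro mult_mono) auto
        also have "\<dots> = 2 * (\<mu> * \<bar>s\<bar> / p)" by simp
        also have "\<dots> \<le> 2 * 1" using \<mu>(4) p01 by (intro mult_left_mono) auto
        finally show ?thesis by linarith
      qed
      have *: "0 < noise \<rho> n F G" "(1 + 8 * \<theta> * \<rho>) * (ln (expect n F) + ln (expect n G)) +
          (\<Sum>j=1..n. \<theta> * mean n F j * mean n G j + \<theta> * \<rho> / 2 * ((mean n F j)\<^sup>2 + (mean n G j)\<^sup>2))
        \<le> ln (noise \<rho> n F G)"
        using ln_noise_ge[OF \<rho>(1) \<rho>4 \<theta>_def FG pos] by auto
      have "ln p - 3 \<le> (1 + 8 * \<theta> * \<rho>) * ln p + \<theta> * (4 * s / p)"
        using e1 e2 by (simp add: algebra_simps)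
      also have "\<dots> = (1 + 8 * \<theta> * \<rho>) * (ln (expect n F) + ln (expect n G)) + (\<Sum>j=1..n. \<theta> * mean n F j * mean n G j)"
        unfolding s[symmetric] sum_distrib_left mult.assoc unfolding p ln_mult_pos[OF pos] ..
      \<comment> \<open>The squared means carried through the induction are nonnegative and are
        discarded.\<close>
      also have "\<dots> \<le> ln (noise \<rho> n F G)"
        using \<theta> \<rho> by (intro order_trans[OF _ *(2)] add_left_mono sum_mono) auto
      finally have "exp (ln p - 3) \<le> noise \<rho> n F G"
        using *(1) by (simp add: ln_ge_iff)
      moreover have "exp (ln p - 3) = p * exp (- 3)"
        using p01 by (simp add: exp_diff exp_minus divide_inverse)
      moreover have "noise \<rho> n F G = 4 * noise \<rho> n (dderiv i f) (dderiv i g)"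
        unfolding F_def G_def noise_cmult by simp
      ultimately show ?thesis by simp
    qed
    have "\<mu> / 4 * (p * exp (- 3) / 4) \<le> integral {0..1} (\<lambda>\<rho>. noise \<rho> n (dderiv i f) (dderiv i g))"
      using nn \<mu> main by (intro integral_noise_ge) auto
    then show ?thesis by (simp add: ct mult_ac)
  qed
qed

theorem theorem6:
  "\<exists>c::real. c > 0 \<and>
     (\<forall>n::nat. \<forall>f g :: (nat \<Rightarrow> real) \<Rightarrow> real.
        n \<ge> 1 \<longrightarrow>
        f \<in> cube n \<rightarrow> {0, 1} \<longrightarrow> g \<in> cube n \<rightarrow> {0, 1} \<longrightarrow>
        cube_increasing n f \<longrightarrow> cube_increasing n g \<longrightarrow>
        Cor n f g \<ge>
          c * (\<Sum>i=1..n. corr_term (influence n i f * influence n i g)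
                                    (dot n (Vvec n i f) (Vvec n i g))))"
proof (intro exI[of _ "exp (- 3) / 16"] conjI allI impI)
  fix n :: nat and f g :: "(nat \<Rightarrow> real) \<Rightarrow> real"
  assume "f \<in> cube n \<rightarrow> {0, 1}" "g \<in> cube n \<rightarrow> {0, 1}" "cube_increasing n f" "cube_increasing n g"
  then show "exp (- 3) / 16 * (\<Sum>i=1..n. corr_term (influence n i f * influence n i g)
      (dot n (Vvec n i f) (Vvec n i g))) \<le> Cor n f g"
    unfolding Cor_eq_integral sum_distrib_left by (intro sum_mono corr_term_le_integral)
qed simp

end
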